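(* There is a positive integer $k_0$ such that the following holds. Let $r=2^{1/4}$ and define functions $t_j$ on integers $n\ge k_0$ by $t_0(n)=n$ and, for $j\ge 1$, $t_j(n)=\max\big(k_0,\lceil\log_r t_{j-1}(n)\rceil\big)$. Then for every integer $j\ge 0$ and every $n\ge k_0$ there is a protocol for the $w$-ary game on $[n]$ with alphabet $\{1,\dots,2j+1\}$ (so $w=2j+1$) whose cost is at most $t_j(n)$.
   Context: The $w$-ary game on $[n]$: Alice receives, as a stream, a permutation $\sigma=(\sigma_1,\dots,\sigma_n)$ of $[n]=\{1,\dots,n\}$ followed by a symbol $b\in\{1,\dots,w\}$. She has an array $\mathbf{v}=(v_1,\dots,v_n)$ whose cells are initially empty. For each $i<n$, upon receiving $\sigma_i$ she writes a symbol from $\{1,\dots,w\}$ in cell $\sigma_i$; this symbol may depend on $\sigma_1,\dots,\sigma_i$, and once written cannot be changed. Upon receiving $\sigma_n$ and $b$ she writes $b$ in cell $\sigma_n$. Bob receives the completed array $\mathbf{v}\in\{1,\dots,w\}^n$ and outputs a set $J\subseteq[n]$ as a function of $\mathbf{v}$. A protocol is valid if $\sigma_n\in J$ for all $\sigma,b$; its cost is the maximum of $|J|$ over all $\sigma,b$. Protocols are required to be valid. *)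

theory Defs
  imports Complex_Main
begin

text \<open>A permutation sigma = (sigma_1,...,sigma_n) of [n] = {1..n} is a list
  (sigma ! i is sigma_(i+1)).\<close>
definition is_perm_list :: "nat \<Rightarrow> nat list \<Rightarrow> bool" where
  "is_perm_list n \<sigma> \<longleftrightarrow> length \<sigma> = n \<and> distinct \<sigma> \<and> set \<sigma> = {1..n}"

text \<open>Alice's strategy A maps the received prefix (sigma_1,...,sigma_i) to the symbol
  written in cell sigma_i.  The completed array (cells outside [n] are set to 0):
  cell sigma_n holds b, cell sigma_i (i < n) holds A (sigma_1,...,sigma_i).\<close>
definition completed_array :: "nat \<Rightarrow> (nat list \<Rightarrow> nat) \<Rightarrow> nat list \<Rightarrow> nat \<Rightarrow> (nat \<Rightarrow> nat)" where
  "completed_array n A \<sigma> b = (\<lambda>c.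
     if c = \<sigma> ! (n - 1) then b
     else if (\<exists>i. i < n - 1 \<and> \<sigma> ! i = c)
          then A (take (Suc (THE i. i < n - 1 \<and> \<sigma> ! i = c)) \<sigma>)
          else 0)"

definition has_protocol :: "nat \<Rightarrow> nat \<Rightarrow> nat \<Rightarrow> bool" where
  "has_protocol n w t \<longleftrightarrow>
     (\<exists>(A :: nat list \<Rightarrow> nat) (B :: (nat \<Rightarrow> nat) \<Rightarrow> nat set).
        (\<forall>\<sigma> i. is_perm_list n \<sigma> \<and> 1 \<le> i \<and> i < n \<longrightarrow> A (take i \<sigma>) \<in> {1..w}) \<and>
        (\<forall>\<sigma> b. is_perm_list n \<sigma> \<and> b \<in> {1..w} \<longrightarrow>
            (let J = B (completed_array n A \<sigma> b) in
               J \<subseteq> {1..n} \<and> \<sigma> ! (n - 1) \<in> J \<and> card J \<le> t)))"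

fun tseq :: "nat \<Rightarrow> nat \<Rightarrow> nat \<Rightarrow> nat" where
  "tseq k0 0 n = n"
| "tseq k0 (Suc j) n = max k0 (nat \<lceil>log (2 powr (1/4)) (real (tseq k0 j n))\<rceil>)"

end

theory Submission
  imports Defs "HOL-Real_Asymp.Real_Asymp"
begin

text \<open>The game on \<open>n\<close> cells reduces to the game on the last \<open>m = \<lceil>4 log\<^sub>2 n\<rceil>\<close> cells at the price
  of two symbols. Alice writes \<open>0\<close> until a set \<open>S\<close> of \<open>m\<close> empty cells remains. On \<open>S\<close> she follows a strategy for
  the smaller game, except that its own \<open>0\<close> is replaced by \<open>1\<close> or \<open>2\<close>, as prescribed by a codeword
  \<open>C S\<close>. If the last cell \<open>x\<close> receives a nonzero symbol, Bob sees \<open>S\<close>, so either \<open>x\<close> contradicts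
  the codeword or he can play the smaller game. If \<open>x\<close> receives \<open>0\<close>, Bob sees \<open>S - {x}\<close> and, outside
  the fewer than \<open>e\<close> cells where the inner strategy has left its own first phase, the codeword of
  \<open>S\<close>; this determines \<open>x\<close> as soon as the codewords of \<open>R \<union> {x}\<close> and \<open>R \<union> {y}\<close> always differ in at
  least \<open>e\<close> places of \<open>R\<close>. Since \<open>2 ^ m \<ge> n ^ 4\<close> while \<open>e\<close> is only about \<open>4 log\<^sub>2 m\<close>, such a code exists.\<close>

section \<open>Codes indexed by the sets of remaining cells\<close>

text \<open>Padding with \<open>None\<close> turns each such \<open>D\<close> into a list of length
  exactly \<open>e\<close> over \<open>S\<close> and one extra letter, and \<open>D\<close> can be
  read off from that list.\<close>

lemma card_small_subsets_le:
  assumes "finite S"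
  shows "card {D. D \<subseteq> S \<and> card D \<le> e} \<le> Suc (card S) ^ e"
proof -
  let ?O = "insert None (Some ` S)"
  let ?L = "{l. set l \<subseteq> ?O \<and> length l = e}"
  have fin: "finite ?O" using assms by simp
  have "{D. D \<subseteq> S \<and> card D \<le> e} \<subseteq> (\<lambda>l. {c. Some c \<in> set l}) ` ?L"
  proof
    fix D assume "D \<in> {D. D \<subseteq> S \<and> card D \<le> e}"
    then have D: "D \<subseteq> S" "card D \<le> e" by auto
    obtain l where l: "set l = D" "length l = card D"
      using finite_distinct_list[OF finite_subset[OF D(1) assms]] distinct_card by metis
    let ?l = "map Some l @ replicate (e - card D) None"
    have "?l \<in> ?L" "D = {c. Some c \<in> set ?l}" using D l by auto
    then show "D \<in> (\<lambda>l. {c. Some c \<in> set l}) ` ?L" by blast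
  qed
  then have "card {D. D \<subseteq> S \<and> card D \<le> e} \<le> card ?L"
    by (rule surj_card_le[OF finite_lists_length_eq[OF fin]])
  also have "\<dots> = card ?O ^ e" by (rule card_lists_length_eq[OF fin])
  also have "card ?O = Suc (card S)" using assms by (simp add: card_image)
  finally show ?thesis .
qed

lemma card_Int_eq_card_minus_one:
  assumes "finite S" "finite S'" "card S = card S'" "Suc (card (S \<inter> S')) = card S"
  obtains x y where "x \<in> S" "y \<in> S'" "S' = insert y (S - {x})" "S \<inter> S' = S - {x}"
proof -
  have "card (S - S') = 1" "card (S' - S) = 1"
    using assms by (auto simp: card_Diff_subset_Int Int_commute)
  then obtain x y where "S - S' = {x}" "S' - S = {y}" by (auto simp: card_1_singleton_iff)
  then show ?thesis by (intro that[of x y]) auto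
qed

text \<open>The bit of the codeword \<open>C S\<close> at a cell \<open>c\<close> is whether
  \<open>c \<in> C S\<close>. For sets of size \<open>m\<close> the premise says that
  \<open>S\<close> and \<open>S'\<close> arise from one common set by adding two different cells:
  the situation in which Bob must tell candidates apart.\<close>

definition far_on_overlaps :: "nat \<Rightarrow> nat \<Rightarrow> 'a set set \<Rightarrow> ('a set \<Rightarrow> 'a set) \<Rightarrow> bool" where
  "far_on_overlaps m e F C \<longleftrightarrow> (\<forall>S\<in>F. \<forall>S'\<in>F. Suc (card (S \<inter> S')) = m \<longrightarrow>
     e \<le> card {c \<in> S \<inter> S'. (c \<in> C S) \<noteq> (c \<in> C S')})"

text \<open>Greedy choice of codewords: a word that is too close to an already chosen \<open>C S'\<close> is
  determined by the exchanged pair \<open>x, y\<close> and by the set of at most \<open>e\<close> disagreements.\<close>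
lemma far_on_overlaps_exists:
  fixes X :: "'a set"
  assumes X: "finite X" and less: "m * card X * Suc m ^ e < 2 ^ m"
    and F: "finite F" "F \<subseteq> {S. S \<subseteq> X \<and> card S = m}"
  shows "\<exists>C. far_on_overlaps m e F C"
  using F
proof (induction F rule: finite_induct)
  case empty
  then show ?case by (simp add: far_on_overlaps_def)
next
  case (insert S F)
  then obtain C where C: "far_on_overlaps m e F C" by auto
  have S: "S \<subseteq> X" "card S = m" "finite S" using insert.prems X finite_subset by auto
  define bad where "bad = {W. W \<subseteq> S \<and> (\<exists>S'\<in>F. Suc (card (S \<inter> S')) = m \<and>
    card {c \<in> S \<inter> S'. (c \<in> W) \<noteq> (c \<in> C S')} < e)}"
  let ?Ds = "{D. D \<subseteq> S \<and> card D \<le> e}"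
  let ?T = "S \<times> X \<times> ?Ds"
  let ?g = "\<lambda>(x, y, D). {c \<in> S. (c \<in> C (insert y (S - {x}))) \<noteq> (c \<in> D)}"
  have "bad \<subseteq> ?g ` ?T"
  proof
    fix W assume "W \<in> bad"
    then obtain S' where W: "W \<subseteq> S" and S': "S' \<in> F" "Suc (card (S \<inter> S')) = m"
      and few: "card {c \<in> S \<inter> S'. (c \<in> W) \<noteq> (c \<in> C S')} < e" by (auto simp: bad_def)
    have S'X: "S' \<subseteq> X" "card S' = m" "finite S'" using insert.prems S' X finite_subset by auto
    obtain x y where xy: "x \<in> S" "y \<in> S'" "S' = insert y (S - {x})" "S \<inter> S' = S - {x}"
      using card_Int_eq_card_minus_one[of S S'] S S' S'X by metis
    \<comment> \<open>\<open>D\<close> ranges over all of \<open>S\<close> and may contain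
      \<open>x\<close>, a cell outside the overlap. This is why \<open>?Ds\<close> allows
      \<open>e\<close> elements and not just \<open>e - 1\<close>.\<close>
    define D where "D = {c \<in> S. (c \<in> W) \<noteq> (c \<in> C S')}"
    have "D \<subseteq> insert x {c \<in> S \<inter> S'. (c \<in> W) \<noteq> (c \<in> C S')}"
      unfolding D_def xy(4) by auto
    then have "card D \<le> Suc (card {c \<in> S \<inter> S'. (c \<in> W) \<noteq> (c \<in> C S')})"
      using S card_mono[of "insert x {c \<in> S \<inter> S'. (c \<in> W) \<noteq> (c \<in> C S')}" D]
      by (auto simp: card_insert_if intro: le_SucI split: if_splits)
    then have "D \<in> ?Ds" using few by (auto simp: D_def)
    moreover have "W = ?g (x, y, D)" using W xy(3) by (auto simp: D_def)
    ultimately show "W \<in> ?g ` ?T" using xy S'X by blast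
  qed
  moreover have fin: "finite ?T" using S X by simp
  ultimately have "card bad \<le> card ?T" by (rule surj_card_le[rotated])
  also have "\<dots> = m * (card X * card ?Ds)" using S by (simp add: card_cartesian_product)
  also have "\<dots> \<le> m * (card X * Suc m ^ e)"
    using card_small_subsets_le[OF S(3), of e] S by simp
  also have "\<dots> < card (Pow S)" using less S by (simp add: card_Pow mult.assoc)
  finally have "\<not> Pow S \<subseteq> bad"
    using card_mono[of bad "Pow S"] S by (auto simp: bad_def)
  then obtain W where W: "W \<subseteq> S" "W \<notin> bad" by blast
  have far: "e \<le> card {c \<in> S \<inter> S'. (c \<in> W) \<noteq> (c \<in> C S')}"
    if "S' \<in> F" "Suc (card (S \<inter> S')) = m" for S'
    using W that by (auto simp: bad_def not_less)
  have "far_on_overlaps m e (insert S F) (C(S := W))"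
    unfolding far_on_overlaps_def
  proof (intro ballI impI)
    fix P Q assume PQ: "P \<in> insert S F" "Q \<in> insert S F" "Suc (card (P \<inter> Q)) = m"
    show "e \<le> card {c \<in> P \<inter> Q. (c \<in> (C(S := W)) P) \<noteq> (c \<in> (C(S := W)) Q)}"
    proof (cases "P = S"; cases "Q = S")
      assume "P = S" "Q = S"
      then show ?thesis using PQ S by simp
    next
      assume "P = S" "Q \<noteq> S"
      then show ?thesis using far[of Q] PQ by simp
    next
      assume "P \<noteq> S" "Q = S"
      moreover have "{c \<in> P \<inter> S. (c \<in> C P) \<noteq> (c \<in> W)} = {c \<in> S \<inter> P. (c \<in> W) \<noteq> (c \<in> C P)}"
        by auto
      ultimately show ?thesis using far[of P] PQ by (simp add: Int_commute)
    next
      assume "P \<noteq> S" "Q \<noteq> S"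
      then show ?thesis using C PQ by (auto simp: far_on_overlaps_def)
    qed
  qed
  then show ?case by blast
qed

section \<open>Reducing a game to its last cells\<close>

text \<open>The game on a cell set \<open>X\<close> with symbols \<open>0..<w\<close>, where in addition Alice writes \<open>0\<close> exactly
  as long as at least \<open>e\<close> cells remain empty afterwards.\<close>
definition winning ::
  "nat set \<Rightarrow> nat \<Rightarrow> nat \<Rightarrow> nat \<Rightarrow> (nat list \<Rightarrow> nat) \<Rightarrow> ((nat \<Rightarrow> nat) \<Rightarrow> nat set) \<Rightarrow> bool" where
  "winning X e w t A B \<longleftrightarrow> (\<forall>\<sigma>. distinct \<sigma> \<and> set \<sigma> = X \<longrightarrow>
     (\<forall>i. 0 < i \<and> i < card X \<longrightarrow>
        A (take i \<sigma>) < w \<and> (A (take i \<sigma>) = 0 \<longleftrightarrow> i + e \<le> card X)) \<and>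
     (\<forall>v. (\<forall>i. Suc i < card X \<longrightarrow> v (\<sigma> ! i) = A (take (Suc i) \<sigma>)) \<and> v (last \<sigma>) < w \<longrightarrow>
        B v \<subseteq> X \<and> last \<sigma> \<in> B v \<and> card (B v) \<le> t))"

text \<open>With \<open>e = 1\<close> the zero phase lasts until only the last cell is empty, so one
  symbol suffices and Bob names every cell.\<close>

lemma winning_trivial:
  assumes "card X = n" "0 < n" "n \<le> t"
  shows "winning X 1 1 t (\<lambda>_. 0) (\<lambda>_. X)"
  using assms unfolding winning_def by (auto intro!: last_in_set)

text \<open>The inner zero phase ends fewer than \<open>e\<close> cells before the last one, so a
  code of distance \<open>e\<close> survives the loss of those bits. In the new game
  \<open>m\<close> takes over the role of \<open>e\<close>, which lets the step be iterated.\<close>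

lemma winning_step:
  fixes X :: "nat set"
  assumes cX: "card X = n" and m: "0 < m" "m \<le> n" and e: "0 < e" and t: "0 < t" and w: "0 < w"
    and less: "m * n * Suc m ^ e < 2 ^ m"
    and inner: "\<And>S. S \<subseteq> X \<Longrightarrow> card S = m \<Longrightarrow> winning S e w t (A S) (B S)"
  shows "\<exists>A B. winning X m (w + 2) t A B"
proof -
  have finX: "finite X" using cX m by (intro card_ge_0_finite) simp
  let ?F = "{S. S \<subseteq> X \<and> card S = m}"
  obtain C where C: "far_on_overlaps m e ?F C"
    using far_on_overlaps_exists[OF finX, of m e ?F] less cX finX by auto
  \<comment> \<open>\<open>S\<close> is recomputed from the first \<open>n - m\<close> cells of the
    prefix, and \<open>last p\<close> is the cell being filled. An inner \<open>0\<close> becomes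
    the codeword bit \<open>1\<close> or \<open>2\<close>; other inner symbols move to
    \<open>3\<close> and above.\<close>
  define A' where "A' p = (if length p + m \<le> n then 0 else
    let S = X - set (take (n - m) p); a = A S (drop (n - m) p) in
      if a = 0 then 1 + of_bool (last p \<in> C S) else a + 2)" for p
  define R where "R v = {c \<in> X. v c \<noteq> 0}" for v :: "nat \<Rightarrow> nat"
  \<comment> \<open>Symbols from \<open>3\<close> on carry no codeword bit and hence fit every
    codeword.\<close>
  define ok where "ok v S c \<longleftrightarrow> v c < 3 \<longrightarrow> v c = 1 + of_bool (c \<in> C S)" for v :: "nat \<Rightarrow> nat" and S c
  \<comment> \<open>\<open>card (R v) = m\<close> holds exactly when the last cell received a
    nonzero symbol. The truncated \<open>v c - 2\<close> sends both \<open>1\<close> and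
    \<open>2\<close> back to the inner \<open>0\<close>.\<close>
  define B' where "B' v = (if card (R v) = m then
      (if \<forall>c\<in>R v. ok v (R v) c then B (R v) (\<lambda>c. v c - 2) else {c \<in> R v. \<not> ok v (R v) c})
    else {y \<in> X - R v. \<forall>c\<in>R v. ok v (insert y (R v)) c})" for v
  have "winning X m (w + 2) t A' B'"
    unfolding winning_def
  proof (intro allI impI, elim conjE)
    fix \<sigma> assume \<sigma>: "distinct \<sigma>" "set \<sigma> = X"
    have len: "length \<sigma> = n" using \<sigma> cX distinct_card by fastforce
    define S where "S = X - set (take (n - m) \<sigma>)"
    define \<tau> where "\<tau> = drop (n - m) \<sigma>"
    have split: "\<sigma> = take (n - m) \<sigma> @ \<tau>" by (simp add: \<tau>_def)
    have \<tau>: "distinct \<tau>" "set \<tau> = S" "length \<tau> = m"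
    proof -
      show "distinct \<tau>" using \<sigma> by (simp add: \<tau>_def)
      have "distinct (take (n - m) \<sigma> @ \<tau>)" "set (take (n - m) \<sigma>) \<union> set \<tau> = X"
        using \<sigma> split by (metis, metis set_append)
      then show "set \<tau> = S" unfolding S_def by auto
      show "length \<tau> = m" using len m by (simp add: \<tau>_def)
    qed
    have cS: "card S = m" using \<tau> distinct_card by fastforce
    have SX: "S \<subseteq> X" by (simp add: S_def)
    have last: "last \<tau> = last \<sigma>" using len m by (simp add: \<tau>_def last_drop)
    have win: "winning S e w t (A S) (B S)" using inner SX cS by simp
    have innerA: "A S (take k \<tau>) < w" "A S (take k \<tau>) = 0 \<longleftrightarrow> k + e \<le> m"
      if "0 < k" "k < m" for k
      using win \<tau> cS that unfolding winning_def by auto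
    have A'_early: "A' (take i \<sigma>) = 0" if "i + m \<le> n" for i
      using that len by (simp add: A'_def)
    have A'_late: "A' (take (n - m + Suc k) \<sigma>) =
        (let a = A S (take (Suc k) \<tau>) in if a = 0 then 1 + of_bool (\<tau> ! k \<in> C S) else a + 2)"
      if "Suc k < m" for k
    proof -
      have "take (n - m) (take (n - m + Suc k) \<sigma>) = take (n - m) \<sigma>" by simp
      moreover have "drop (n - m) (take (n - m + Suc k) \<sigma>) = take (Suc k) \<tau>"
        by (simp add: \<tau>_def take_drop add.commute)
      moreover have "last (take (n - m + Suc k) \<sigma>) = \<tau> ! k"
        using that len m by (simp add: \<tau>_def take_Suc_conv_app_nth)
      ultimately show ?thesis using that len m by (simp add: A'_def S_def Let_def)
    qed
    have part1: "A' (take i \<sigma>) < w + 2 \<and> (A' (take i \<sigma>) = 0 \<longleftrightarrow> i + m \<le> card X)"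
      if i: "0 < i" "i < card X" for i
    proof (cases "i + m \<le> n")
      case True
      then show ?thesis using A'_early cX by simp
    next
      case False
      define k where "k = i - (n - m) - 1"
      have k: "i = n - m + Suc k" "Suc k < m" using False i cX m by (auto simp: k_def)
      have "A' (take i \<sigma>) \<noteq> 0" "A' (take i \<sigma>) < w + 2"
        using innerA(1)[of "Suc k"] k A'_late[OF k(2)] by (auto simp: Let_def)
      then show ?thesis using False cX by simp
    qed
    have part2: "B' v \<subseteq> X \<and> last \<sigma> \<in> B' v \<and> card (B' v) \<le> t"
      if v: "\<forall>i. Suc i < card X \<longrightarrow> v (\<sigma> ! i) = A' (take (Suc i) \<sigma>)" "v (last \<sigma>) < w + 2" for v
    proof -
      define x where "x = last \<sigma>"
      have x: "x = \<tau> ! (m - 1)" "x \<in> S"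
        using last \<tau> m last_in_set[of \<tau>] by (auto simp: x_def last_conv_nth)
      have v_\<tau>: "v (\<tau> ! k) = (let a = A S (take (Suc k) \<tau>) in
          if a = 0 then 1 + of_bool (\<tau> ! k \<in> C S) else a + 2)" if "Suc k < m" for k
      proof -
        have "v (\<sigma> ! (n - m + k)) = A' (take (Suc (n - m + k)) \<sigma>)"
          using v(1) that m cX by auto
        then show ?thesis using A'_late[OF that] len m that by (simp add: \<tau>_def)
      qed
      have index: "\<exists>k. Suc k < m \<and> c = \<tau> ! k" if c: "c \<in> S - {x}" for c
      proof -
        obtain k where "k < m" "c = \<tau> ! k" using c \<tau> by (metis Diff_iff in_set_conv_nth)
        moreover have "k \<noteq> m - 1" using c x calculation by auto
        ultimately show ?thesis by (intro exI[of _ k]) auto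
      qed
      have v_S: "v c \<noteq> 0" "ok v S c" if c: "c \<in> S - {x}" for c
        using index[OF c] v_\<tau> by (auto simp: Let_def ok_def split: if_splits)
      have v_out: "v c = 0" if "c \<in> X - S" for c
      proof -
        have "c \<in> set (take (n - m) \<sigma>)" using that by (auto simp: S_def)
        then obtain i where i: "i < n - m" "c = \<sigma> ! i" by (auto simp: in_set_conv_nth)
        then have "v c = A' (take (Suc i) \<sigma>)" using v(1) m cX by auto
        then show ?thesis using A'_early[of "Suc i"] i by simp
      qed
      have R_iff: "c \<in> R v \<longleftrightarrow> c \<in> S" if "c \<noteq> x" for c
        using v_S(1)[of c] v_out[of c] that SX by (cases "c \<in> S"; cases "c \<in> X") (auto simp: R_def)
      show ?thesis
      proof (cases "v x = 0")
        case False
        have RS: "R v = S"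
        proof (rule set_eqI)
          show "c \<in> R v \<longleftrightarrow> c \<in> S" for c
            using R_iff[of c] False x(2) SX by (cases "c = x") (auto simp: R_def)
        qed
        show ?thesis
        \<comment> \<open>If \<open>x\<close> fits the codeword, the array decodes to a legal play
          of the inner game, whose last symbol is arbitrary. Otherwise \<open>x\<close> is the only
          cell that does not fit.\<close>
        proof (cases "ok v S x")
          case True
          then have "\<forall>c\<in>S. ok v S c" using v_S(2) by blast
          then have B': "B' v = B S (\<lambda>c. v c - 2)" by (simp add: B'_def RS cS)
          have "v (\<tau> ! i) - 2 = A S (take (Suc i) \<tau>)" if "Suc i < card S" for i
            using v_\<tau>[of i] that cS by (auto simp: Let_def)
          then have "B S (\<lambda>c. v c - 2) \<subseteq> S \<and> last \<tau> \<in> B S (\<lambda>c. v c - 2) \<and>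
              card (B S (\<lambda>c. v c - 2)) \<le> t"
            using win \<tau> v(2) w last unfolding winning_def by auto
          then show ?thesis using B' SX last by auto
        next
          case notok: False
          then have "{c \<in> S. \<not> ok v S c} = {x}" using v_S(2) x(2) by blast
          then have "B' v = {x}" using notok x(2) by (auto simp: B'_def RS cS)
          then show ?thesis using t x SX by (auto simp: x_def)
        qed
      next
        case True
        have RS: "R v = S - {x}"
        proof (rule set_eqI)
          show "c \<in> R v \<longleftrightarrow> c \<in> S - {x}" for c
            using R_iff[of c] True by (cases "c = x") (auto simp: R_def)
        qed
        have cR: "Suc (card (S - {x})) = m"
          using cS x m by (metis card_Suc_Diff1 card_ge_0_finite)
        \<comment> \<open>\<open>E\<close> collects the cells whose codeword bit is lost. They are
          filled after the inner zero phase and before \<open>x\<close>, which leaves at most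
          \<open>e - 1\<close> positions.\<close>
        define E where "E = {c \<in> S - {x}. 3 \<le> v c}"
        have "E \<subseteq> (\<lambda>k. \<tau> ! k) ` {m - e..<m - 1}"
        proof
          fix c assume "c \<in> E"
          then obtain k where k: "Suc k < m" "c = \<tau> ! k" and 3: "3 \<le> v c"
            using index by (auto simp: E_def)
          have "A S (take (Suc k) \<tau>) \<noteq> 0" using v_\<tau>[OF k(1)] k(2) 3
            by (auto simp: Let_def of_bool_def split: if_splits)
          then have "\<not> Suc k + e \<le> m" using innerA(2)[of "Suc k"] k by auto
          then have "k \<in> {m - e..<m - 1}" using k(1) by auto
          then show "c \<in> (\<lambda>k. \<tau> ! k) ` {m - e..<m - 1}" using k(2) by blast
        qed
        then have "card E \<le> card {m - e..<m - 1}" by (rule surj_card_le[rotated]) simp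
        then have cE: "card E < e" using e by auto
        \<comment> \<open>Off \<open>E\<close>, the array shows the bits of both \<open>C S\<close>
          and \<open>C S'\<close>, so these could differ only on \<open>E\<close>, in fewer than
          \<open>e\<close> places.\<close>
        have "y = x" if y: "y \<in> X - (S - {x})" "\<forall>c\<in>S - {x}. ok v (insert y (S - {x})) c" for y
        proof (rule ccontr)
          assume "y \<noteq> x"
          define S' where "S' = insert y (S - {x})"
          have Int: "S \<inter> S' = S - {x}" using y \<open>y \<noteq> x\<close> by (auto simp: S'_def)
          have "S' \<in> ?F" using y cR SX finite_subset[OF SX finX] by (auto simp: S'_def)
          moreover have "S \<in> ?F" "Suc (card (S \<inter> S')) = m" using SX cS cR Int by auto
          ultimately have far: "e \<le> card {c \<in> S \<inter> S'. (c \<in> C S) \<noteq> (c \<in> C S')}"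
            using C unfolding far_on_overlaps_def by blast
          have "{c \<in> S \<inter> S'. (c \<in> C S) \<noteq> (c \<in> C S')} \<subseteq> E"
          proof
            fix c assume c: "c \<in> {c \<in> S \<inter> S'. (c \<in> C S) \<noteq> (c \<in> C S')}"
            then have "c \<in> S - {x}" using Int by blast
            then have "ok v S c" "ok v S' c" using y v_S(2) by (auto simp: S'_def)
            then have "3 \<le> v c" using c by (auto simp: ok_def not_less[symmetric])
            then show "c \<in> E" using \<open>c \<in> S - {x}\<close> by (simp add: E_def)
          qed
          then have "card {c \<in> S \<inter> S'. (c \<in> C S) \<noteq> (c \<in> C S')} \<le> card E"
            using finite_subset[OF SX finX] by (intro card_mono) (auto simp: E_def)
          then show False using far cE by simp
        qed
        moreover have "\<forall>c\<in>S - {x}. ok v (insert x (S - {x})) c"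
          using v_S(2) x(2) by (simp add: insert_absorb)
        ultimately have "{y \<in> X - (S - {x}). \<forall>c\<in>S - {x}. ok v (insert y (S - {x})) c} = {x}"
          using x(2) SX by blast
        then have "B' v = {x}" using cR by (simp add: B'_def RS)
        then show ?thesis using t x SX by (auto simp: x_def)
      qed
    qed
    show "(\<forall>i. 0 < i \<and> i < card X \<longrightarrow>
        A' (take i \<sigma>) < w + 2 \<and> (A' (take i \<sigma>) = 0 \<longleftrightarrow> i + m \<le> card X)) \<and>
      (\<forall>v. (\<forall>i. Suc i < card X \<longrightarrow> v (\<sigma> ! i) = A' (take (Suc i) \<sigma>)) \<and> v (last \<sigma>) < w + 2 \<longrightarrow>
        B' v \<subseteq> X \<and> last \<sigma> \<in> B' v \<and> card (B' v) \<le> t)"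
      using part1 part2 by blast
  qed
  then show ?thesis by blast
qed

text \<open>Symbols shift from \<open>0..<w\<close> to \<open>1..w\<close>. Alice never writes above
  \<open>w\<close>, so a final symbol \<open>b > w\<close> reveals the last cell at once.\<close>

lemma has_protocol_if_winning:
  assumes win: "winning {1..n} e w t A B" and n: "0 < n" and w: "w \<le> w'" and t: "0 < t"
  shows "has_protocol n w' t"
proof -
  define B' where "B' v = (if \<exists>c\<in>{1..n}. w < v c then {c \<in> {1..n}. w < v c} else B (\<lambda>c. v c - 1))"
    for v :: "nat \<Rightarrow> nat"
  show ?thesis
    unfolding has_protocol_def
  proof (intro exI[of _ "\<lambda>p. Suc (A p)"] exI[of _ B'] conjI allI impI; elim conjE)
    fix \<sigma> i assume "is_perm_list n \<sigma>" "1 \<le> i" "i < n"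
    then have "A (take i \<sigma>) < w" using win by (auto simp: is_perm_list_def winning_def)
    then show "Suc (A (take i \<sigma>)) \<in> {1..w'}" using w by simp
  next
    fix \<sigma> b assume perm: "is_perm_list n \<sigma>" and b: "b \<in> {1..w'}"
    have \<sigma>: "length \<sigma> = n" "distinct \<sigma>" "set \<sigma> = {1..n}" using perm by (auto simp: is_perm_list_def)
    define v where "v = completed_array n (\<lambda>p. Suc (A p)) \<sigma> b"
    have "\<sigma> \<noteq> []" using \<sigma> n by auto
    then have last: "last \<sigma> = \<sigma> ! (n - 1)" "last \<sigma> \<in> {1..n}"
      using \<sigma> last_in_set[of \<sigma>] by (auto simp: last_conv_nth)
    have v_last: "v (last \<sigma>) = b" by (simp add: v_def completed_array_def last)
    have v_nth: "v (\<sigma> ! i) = Suc (A (take (Suc i) \<sigma>))" if i: "Suc i < n" for i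
    proof -
      have "(THE k. k < n - 1 \<and> \<sigma> ! k = \<sigma> ! i) = i"
        using \<sigma> i by (intro the_equality) (auto simp: nth_eq_iff_index_eq)
      moreover have "\<sigma> ! i \<noteq> \<sigma> ! (n - 1)" using \<sigma> i by (auto simp: nth_eq_iff_index_eq)
      moreover have "\<exists>k<n - 1. \<sigma> ! k = \<sigma> ! i" using i by (intro exI[of _ i]) auto
      ultimately show ?thesis by (simp add: v_def completed_array_def)
    qed
    have v_le: "v c \<le> w" if c: "c \<in> {1..n}" "c \<noteq> last \<sigma>" for c
    proof -
      obtain i where i: "i < n" "c = \<sigma> ! i" using c \<sigma> by (metis in_set_conv_nth)
      have "i \<noteq> n - 1" using i c last by auto
      then have "Suc i < n" using i by simp
      moreover have "A (take (Suc i) \<sigma>) < w"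
        using win \<sigma> calculation by (auto simp: winning_def)
      ultimately show ?thesis using v_nth i by auto
    qed
    have "B' v \<subseteq> {1..n} \<and> last \<sigma> \<in> B' v \<and> card (B' v) \<le> t"
    proof (cases "w < b")
      case True
      then have "{c \<in> {1..n}. w < v c} = {last \<sigma>}"
        using v_le v_last last(2) by (auto simp: not_less[symmetric])
      then have "B' v = {last \<sigma>}" using True v_last last(2) unfolding B'_def by auto
      then show ?thesis using t last by auto
    next
      case False
      then have "\<not> (\<exists>c\<in>{1..n}. w < v c)" using v_le v_last by (metis not_less)
      then have "B' v = B (\<lambda>c. v c - 1)" by (simp add: B'_def)
      moreover have "v (last \<sigma>) - 1 < w" using v_last b False by auto
      ultimately show ?thesis
        using win \<sigma> v_nth unfolding winning_def by auto
    qed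
    then show "let J = B' (completed_array n (\<lambda>p. Suc (A p)) \<sigma> b) in
        J \<subseteq> {1..n} \<and> \<sigma> ! (n - 1) \<in> J \<and> card J \<le> t"
      by (simp add: v_def last Let_def)
  qed
qed

section \<open>Iterating the reduction\<close>

definition loglen :: "nat \<Rightarrow> nat" where
  "loglen n = nat \<lceil>log (2 powr (1/4)) (real n)\<rceil>"

text \<open>\<open>tseq\<close> unfolds at its last logarithm, whereas the reduction from
  \<open>n\<close> to \<open>loglen n\<close> cells uses up the first.\<close>

lemma tseq_Suc_shift: "tseq k0 (Suc j) n = tseq k0 j (max k0 (loglen n))"
  by (induction j) (simp_all add: loglen_def)

lemma le_tseq: "k0 \<le> n \<Longrightarrow> k0 \<le> tseq k0 j n"
  by (cases j) auto

lemma log_root_eq: "log (2 powr (1/4)) x = 4 * log 2 x"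
  by (simp add: log_def ln_powr)

lemma loglen_bounds:
  assumes "0 < n"
  shows "4 * log 2 n \<le> loglen n" "loglen n < 4 * log 2 n + 1"
proof -
  have "0 \<le> log 2 n" using assms by simp
  then show "4 * log 2 n \<le> loglen n" "loglen n < 4 * log 2 n + 1"
    unfolding loglen_def log_root_eq by linarith+
qed

lemma loglen_pos:
  assumes "2 \<le> n"
  shows "0 < loglen n"
proof -
  have "0 < log 2 (real n)" using assms by simp
  then show ?thesis using loglen_bounds(1)[of n] assms by linarith
qed

text \<open>With \<open>m = loglen n\<close> one has \<open>n \<le> 2 powr (m / 4)\<close>, so the
  remaining factor, quasi-polynomial in \<open>m\<close>, only has to stay below
  \<open>2 powr (3/4 * m)\<close>.\<close>

lemma eventually_code_condition:
  "eventually (\<lambda>n. 2 \<le> loglen n \<and> loglen n \<le> n \<and>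
     loglen n * n * Suc (loglen n) ^ loglen (loglen n) < 2 ^ loglen n) sequentially"
proof -
  have "eventually (\<lambda>m::nat. real m * (real m + 1) powr (4 * log 2 m + 1) < 2 powr (3/4 * m)) sequentially"
    by real_asymp
  moreover have "filterlim loglen sequentially sequentially"
  proof -
    have "filterlim (\<lambda>n::nat. 4 * log 2 (real n)) at_top sequentially" by real_asymp
    moreover have "eventually (\<lambda>n. 4 * log 2 (real n) \<le> real (loglen n)) sequentially"
      using eventually_gt_at_top[of 0] by eventually_elim (rule loglen_bounds)
    ultimately have "filterlim (\<lambda>n. real (loglen n)) at_top sequentially"
      by (rule filterlim_at_top_mono)
    then show ?thesis by (simp add: filterlim_sequentially_iff_filterlim_real)
  qed
  ultimately have ev1: "eventually (\<lambda>n. real (loglen n) *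
      (real (loglen n) + 1) powr (4 * log 2 (loglen n) + 1) < 2 powr (3/4 * loglen n)) sequentially"
    and ev2: "eventually (\<lambda>n. 2 \<le> loglen n) sequentially"
    by (auto simp: filterlim_iff eventually_ge_at_top)
  have ev3: "eventually (\<lambda>n::nat. 4 * log 2 (real n) + 1 \<le> real n) sequentially" by real_asymp
  show ?thesis
    using ev1 ev2 ev3 eventually_gt_at_top[of 0]
  proof eventually_elim
    case (elim n)
    define m where "m = loglen n"
    have "real n = 2 powr log 2 n" using elim by simp
    also have "\<dots> \<le> 2 powr (m / 4)" using loglen_bounds(1)[of n] elim
      by (intro powr_mono) (auto simp: m_def)
    finally have n: "real n \<le> 2 powr (m / 4)" .
    have "real (Suc m) ^ loglen m = (real m + 1) powr loglen m"
      by (simp add: powr_realpow add.commute)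
    also have "\<dots> \<le> (real m + 1) powr (4 * log 2 m + 1)"
      using loglen_bounds(2)[of m] elim by (simp add: m_def)
    finally have pow: "real (Suc m) ^ loglen m \<le> (real m + 1) powr (4 * log 2 m + 1)" .
    have "real (m * n * Suc m ^ loglen m) = real n * (real m * real (Suc m) ^ loglen m)"
      by (simp add: mult_ac)
    also have "\<dots> \<le> real n * (real m * (real m + 1) powr (4 * log 2 m + 1))"
      using pow by (intro mult_left_mono) auto
    also have "\<dots> < real n * 2 powr (3/4 * m)"
      using elim by (intro mult_strict_left_mono) (auto simp: m_def)
    also have "\<dots> \<le> 2 powr (m / 4) * 2 powr (3/4 * m)"
      using n by (intro mult_right_mono) auto
    also have "\<dots> = 2 powr m" by (simp flip: powr_add)
    also have "\<dots> = real (2 ^ m)" by (simp add: powr_realpow)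
    finally have "m * n * Suc m ^ loglen m < 2 ^ m" by (simp only: of_nat_less_iff)
    moreover have "loglen n \<le> n" using loglen_bounds(2)[of n] elim by linarith
    ultimately show ?case using elim by (simp add: m_def)
  qed
qed

text \<open>\<open>w\<close> and \<open>e\<close> are chosen before \<open>X\<close>, so all sets of
  remaining cells share them. The bound \<open>e \<le> loglen n\<close> is what makes the code
  condition available one level up.\<close>

lemma winning_tseq:
  assumes k0: "0 < k0"
    and large: "\<And>n. k0 \<le> n \<Longrightarrow> 2 \<le> loglen n \<and> loglen n \<le> n \<and>
      loglen n * n * Suc (loglen n) ^ loglen (loglen n) < 2 ^ loglen n"
    and n: "2 \<le> n"
  shows "\<exists>w e. 0 < w \<and> w \<le> 2 * j + 1 \<and> 0 < e \<and> e \<le> loglen n \<and>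
    (\<forall>X. card X = n \<longrightarrow> (\<exists>A B. winning X e w (tseq k0 j (max k0 n)) A B))"
  using n
proof (induction j arbitrary: n)
  case 0
  have "1 \<le> loglen n" using loglen_pos[of n] 0 by simp
  moreover have "\<exists>A B. winning X 1 1 (max k0 n) A B" if "card X = n" for X
    using winning_trivial[OF that, of "max k0 n"] 0 by fastforce
  ultimately show ?case by (intro exI[of _ 1]) auto
next
  case (Suc j)
  show ?case
  proof (cases "n \<le> k0")
    \<comment> \<open>Every value of \<open>tseq\<close> is at least \<open>k0\<close>, so naming
      all cells is affordable. As the recursion may stop early here, \<open>w\<close> is only
      bounded by \<open>2 * j + 1\<close>.\<close>
    case True
    have "1 \<le> loglen n" using loglen_pos[of n] Suc.prems by simp
    moreover have "\<exists>A B. winning X 1 1 (tseq k0 (Suc j) (max k0 n)) A B" if "card X = n" for X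
    proof -
      have "n \<le> tseq k0 (Suc j) (max k0 n)" using True le_tseq[of k0 "max k0 n" "Suc j"] by linarith
      then show ?thesis using winning_trivial[OF that] Suc.prems by fastforce
    qed
    ultimately show ?thesis by (intro exI[of _ 1]) auto
  next
    case False
    define m where "m = loglen n"
    define t where "t = tseq k0 j (max k0 m)"
    have m: "2 \<le> m" "m \<le> n" "m * n * Suc m ^ loglen m < 2 ^ m"
      using large[of n] False by (auto simp: m_def)
    obtain w e where w: "0 < w" "w \<le> 2 * j + 1" and e: "0 < e" "e \<le> loglen m"
      and IH: "\<And>S. card S = m \<Longrightarrow> \<exists>A B. winning S e w t A B"
      using Suc.IH[OF m(1)] by (auto simp: t_def)
    obtain A B where AB: "\<And>S. card S = m \<Longrightarrow> winning S e w t (A S) (B S)"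
      using IH by metis
    have "Suc m ^ e \<le> Suc m ^ loglen m" using e by (intro power_increasing) auto
    then have less: "m * n * Suc m ^ e < 2 ^ m"
      using m(3) by (meson le_less_trans mult_le_mono2)
    have "0 < t" using le_tseq[of k0 "max k0 m" j] k0 by (simp add: t_def)
    then have "\<exists>A B. winning X m (w + 2) t A B" if "card X = n" for X
      using winning_step[where A = A and B = B, OF that _ m(2) e(1) _ w(1) less] m(1) AB by simp
    moreover have "tseq k0 (Suc j) (max k0 n) = t"
      using False by (simp add: tseq_Suc_shift t_def m_def max_absorb2 del: tseq.simps)
    moreover have "0 < w + 2 \<and> w + 2 \<le> 2 * Suc j + 1 \<and> 0 < m \<and> m \<le> loglen n"
      using w m(1) by (simp add: m_def)
    ultimately show ?thesis by metis
  qed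
qed

theorem theorem2:
  shows "\<exists>k0::nat. k0 > 0 \<and>
           (\<forall>j n. n \<ge> k0 \<longrightarrow> has_protocol n (2 * j + 1) (tseq k0 j n))"
proof -
  obtain k where k: "\<And>n. k \<le> n \<Longrightarrow> 2 \<le> loglen n \<and> loglen n \<le> n \<and>
      loglen n * n * Suc (loglen n) ^ loglen (loglen n) < 2 ^ loglen n"
    using eventually_code_condition by (auto simp: eventually_sequentially)
  \<comment> \<open>The \<open>2\<close> ensures \<open>2 \<le> n\<close>, which keeps
    \<open>loglen n\<close> positive.\<close>
  define k0 where "k0 = max k 2"
  have "has_protocol n (2 * j + 1) (tseq k0 j n)" if n: "k0 \<le> n" for j n
  proof -
    obtain w e where w: "w \<le> 2 * j + 1"
      and win: "\<And>X. card X = n \<Longrightarrow> \<exists>A B. winning X e w (tseq k0 j (max k0 n)) A B"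
      using winning_tseq[of k0 n j, OF _ k] n by (fastforce simp: k0_def)
    obtain A B where "winning {1..n} e w (tseq k0 j n) A B"
      using win[of "{1..n}"] n by (auto simp: max_absorb2)
    then show ?thesis
      using w n le_tseq[OF n, of j] by (intro has_protocol_if_winning) (auto simp: k0_def)
  qed
  then show ?thesis by (intro exI[of _ k0]) (auto simp: k0_def)
qed

end
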